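(* For every integer $n\ge 0$, $$\mathrm{SNO}(5n+4)\equiv 0 \pmod 5,$$ $$\mathrm{SNO}(5n+2)\equiv 0 \pmod 5,$$ $$\mathrm{SNO}(7n+3)\equiv 0 \pmod 7.$$
   Context: An overpartition of a nonnegative integer $n$ is a partition of $n$ (a finite non-increasing sequence of positive integers with sum $n$) in which, for each part size that occurs, the first occurrence of that size may be overlined or not; equivalently, it is a pair consisting of a partition into distinct (overlined) parts and an unrestricted partition (the non-overlined parts) with total sum $n$. $\mathrm{SNO}(n)$ denotes the sum of all the non-overlined parts (counted with multiplicity) in all the overpartitions of $n$. *)

theory Defs
  imports "HOL-Library.Multiset" "HOL-Number_Theory.Cong"
begin

text \<open>
  An overpartition of \<open>n\<close> is given as a pair \<open>(D, P)\<close>: the finite set \<open>D\<close> of its overlined parts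
  (these are distinct, since only the first occurrence of a part size may be overlined) and the
  multiset \<open>P\<close> of its non-overlined parts. A part size may occur in both \<open>D\<close> and \<open>P\<close>.
  Finiteness of \<open>D\<close> is explicit because the sum over an infinite set is 0 by convention.
\<close>

definition overpartitions :: "nat \<Rightarrow> (nat set \<times> nat multiset) set" where
  "overpartitions n =
     {(D, P). finite D \<and> (\<forall>d\<in>D. d > 0) \<and> (\<forall>p\<in>#P. p > 0) \<and> \<Sum>D + \<Sum>\<^sub># P = n}"

definition SNO :: "nat \<Rightarrow> nat" where
  "SNO n = (\<Sum>(D, P)\<in>overpartitions n. \<Sum>\<^sub># P)"

text \<open>The sum defining \<open>SNO\<close> ranges over a finite set, so it is not 0 by convention.\<close>

lemma size_le_sum_mset_pos:
  fixes P :: "nat multiset"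
  assumes "\<forall>p\<in>#P. p > 0"
  shows "size P \<le> \<Sum>\<^sub># P"
  using assms by (induction P) (auto simp: Suc_le_eq)

lemma finite_overpartitions: "finite (overpartitions n)"
proof (rule finite_subset)
  show "overpartitions n \<subseteq> Pow {..n} \<times> (\<Union>k\<le>n. {P. set_mset P \<subseteq> {..n} \<and> size P = k})"
  proof (rule subrelI)
    fix D P assume "(D, P) \<in> overpartitions n"
    then have fin: "finite D" and pos: "\<forall>p\<in>#P. p > 0" and s: "\<Sum>D + \<Sum>\<^sub># P = n"
      by (auto simp: overpartitions_def)
    have "D \<subseteq> {..n}"
    proof
      fix d assume "d \<in> D"
      then have "d \<le> \<Sum>D" using fin member_le_sum[of d D "\<lambda>x. x"] by simp
      then show "d \<in> {..n}" using s by simp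
    qed
    moreover have "set_mset P \<subseteq> {..n}"
    proof
      fix p assume "p \<in># P"
      then have "p \<le> \<Sum>\<^sub># P" by (metis le_add1 multi_member_split sum_mset.add_mset)
      then show "p \<in> {..n}" using s by simp
    qed
    moreover have "size P \<le> n" using size_le_sum_mset_pos[OF pos] s by simp
    ultimately show "(D, P) \<in> Pow {..n} \<times> (\<Union>k\<le>n. {P. set_mset P \<subseteq> {..n} \<and> size P = k})"
      by auto
  qed
  show "finite (Pow {..n} \<times> (\<Union>k\<le>n. {P. set_mset P \<subseteq> {..n} \<and> size P = k}))"
    using finite_multisets_of_size[of "{..n}"]
    by (intro finite_cartesian_product finite_UN_I) (auto simp: multisets_of_size_def)
qed

end

theory Submission
  imports Defs
    "HOL-Computational_Algebra.Formal_Power_Series"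
    "HOL-Computational_Algebra.Polynomial"
begin

text \<open>
  Write \<open>f\<^sub>b\<close> for \<open>\<Prod>i\<ge>1. 1 - q^(b*i)\<close> (the constant \<open>euler b\<close>), \<open>\<theta> = q * d/dq\<close> (\<open>fps_XD\<close>), and \<open>S\<close> for the
  generating series of \<open>SNO\<close>. Overpartitions have the series \<open>P = f\<^sub>2 / f\<^sub>1^2\<close>; weighting a partition by
  its size applies \<open>\<theta>\<close> to the factor \<open>1 / f\<^sub>1\<close>, so \<open>S * f\<^sub>1 = - P * \<theta> f\<^sub>1\<close>.

  For a prime \<open>p\<close>, \<open>\<theta> (f\<^sub>1^p) = p * f\<^sub>1^(p - 1) * \<theta> f\<^sub>1\<close> shows that \<open>f\<^sub>1^p\<close> has coefficients divisible by \<open>p\<close>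
  outside the multiples of \<open>p\<close>. Hence, if \<open>S * f\<^sub>1^p\<close> has all its coefficients in some residue class modulo
  \<open>p\<close> divisible by \<open>p\<close>, so has \<open>S\<close> (\<open>residue_class_dvd\<close>). The products \<open>S * f\<^sub>1^5\<close> and \<open>S * f\<^sub>1^7\<close> turn out
  to be, up to invertible constants and modulo \<open>p\<close>, double sums in which every single term of the
  class in question is divisible by \<open>p\<close>:

  \<^item> \<open>6 * S * f\<^sub>1^5 = - \<theta> (2 * f\<^sub>1^3) * f\<^sub>2\<close>, where Jacobi's identity expands \<open>f\<^sub>1^3\<close> and Euler's pentagonal
    number theorem expands \<open>f\<^sub>2\<close>.

  \<^item> \<open>12 * S * f\<^sub>1^7\<close> is congruent modulo 7 to \<open>3 * \<theta> (2 * f\<^sub>2^3 * Q) - \<theta> (2 * f\<^sub>2^3) * Q\<close> with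
    \<open>Q = f\<^sub>1^5 / f\<^sub>2^2\<close>. Here \<open>f\<^sub>2^3\<close> is again expanded by Jacobi, and \<open>Q\<close> is the theta series
    \<open>\<Sum>k. (6*k + 1) * q^(k*(3*k + 1)/2)\<close> over all integers \<open>k\<close>.

  The expansions of \<open>f\<^sub>b\<close>, \<open>f\<^sub>b^3\<close> and \<open>f\<^sub>2^2 / f\<^sub>1\<close> come from one finite form of the triple product
  (\<open>finite_triple_product\<close>), in which Gaussian binomial coefficients tend to \<open>1 / f\<^sub>b\<close>
  (\<open>agree_theta_series\<close>). The expansion of \<open>Q\<close> is usually deduced from the quintuple product; here it
  follows from \<open>Q * (f\<^sub>2^2 / f\<^sub>1) = f\<^sub>1^3 * f\<^sub>1\<close>, an identity between two theta series of the same binary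
  quadratic form that is proved by a rotation of the index lattice
  (\<open>weighted_pentagonal_mult_triangular\<close>).
\<close>

unbundle fps_syntax

section \<open>Power series up to a given degree\<close>

definition agree_upto :: "nat \<Rightarrow> int fps \<Rightarrow> int fps \<Rightarrow> bool" where
  "agree_upto N f g \<longleftrightarrow> (\<forall>i\<le>N. f $ i = g $ i)"

lemma agree_upto_refl [simp]: "agree_upto N f f"
  by (simp add: agree_upto_def)

lemma agree_upto_sym: "agree_upto N f g \<Longrightarrow> agree_upto N g f"
  by (simp add: agree_upto_def)

lemma agree_upto_trans [trans]: "agree_upto N f g \<Longrightarrow> agree_upto N g h \<Longrightarrow> agree_upto N f h"
  by (simp add: agree_upto_def)

lemma agree_upto_mult: "agree_upto N f g \<Longrightarrow> agree_upto N h k \<Longrightarrow> agree_upto N (f * h) (g * k)"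
  by (auto simp: agree_upto_def fps_mult_nth intro!: sum.cong)

lemma agree_upto_sum: "(\<And>i. i \<in> I \<Longrightarrow> agree_upto N (f i) (g i)) \<Longrightarrow> agree_upto N (sum f I) (sum g I)"
  by (auto simp: agree_upto_def fps_sum_nth intro!: sum.cong)

lemma agree_upto_eqI: "(\<And>N. agree_upto N f g) \<Longrightarrow> f = g"
  by (auto simp: agree_upto_def fps_eq_iff)

text \<open>
  A constant coefficient 1 makes division by \<open>h\<close> possible over the integers, and the quotient up to degree
  \<open>N\<close> involves no later coefficients.
\<close>
lemma agree_upto_cancel:
  assumes "agree_upto N (h * f) (h * g)" "h $ 0 = 1"
  shows "agree_upto N f g"
proof -
  have "f $ i = g $ i" if "i \<le> N" for i
    using that
  proof (induction i rule: less_induct)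
    case (less i)
    have split: "(h * u) $ i = u $ i + (\<Sum>j=1..i. h $ j * u $ (i - j))" for u
      using assms(2) by (simp add: fps_mult_nth sum.atLeast_Suc_atMost)
    have "(\<Sum>j=1..i. h $ j * f $ (i - j)) = (\<Sum>j=1..i. h $ j * g $ (i - j))"
      using less by (intro sum.cong) auto
    moreover have "(h * f) $ i = (h * g) $ i"
      using assms(1) less.prems by (simp add: agree_upto_def)
    ultimately show ?case unfolding split by simp
  qed
  then show ?thesis by (simp add: agree_upto_def)
qed

lemma agree_upto_X_power: "N < m \<Longrightarrow> agree_upto N (f * fps_X ^ m) 0"
  by (simp add: agree_upto_def fps_X_power_mult_right_nth)

section \<open>Series that enumerate weighted index sets\<close>

text \<open>
  Theta series and generating functions of partitions are both of this shape, so that products,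
  derivatives and changes of the index become manipulations of index sets.
\<close>
definition enum_series :: "'i set \<Rightarrow> ('i \<Rightarrow> nat) \<Rightarrow> ('i \<Rightarrow> int) \<Rightarrow> int fps" where
  "enum_series I e w = Abs_fps (\<lambda>n. \<Sum>i\<in>{i\<in>I. e i = n}. w i)"

lemma enum_series_nth: "enum_series I e w $ n = (\<Sum>i\<in>{i\<in>I. e i = n}. w i)"
  by (simp add: enum_series_def)

text \<open>
  A coefficient of \<open>enum_series\<close> over an infinite fibre would be 0 by convention, and products of series
  would no longer correspond to products of index sets.
\<close>
definition finite_fibres :: "'i set \<Rightarrow> ('i \<Rightarrow> nat) \<Rightarrow> bool" where
  "finite_fibres I e \<longleftrightarrow> (\<forall>n. finite {i\<in>I. e i = n})"

lemma enum_series_mult: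
  assumes "finite_fibres I e" "finite_fibres J d"
  shows "enum_series I e v * enum_series J d w =
         enum_series (I \<times> J) (\<lambda>(i, j). e i + d j) (\<lambda>(i, j). v i * w j)"
proof (rule fps_ext)
  fix n
  let ?F = "\<lambda>a. {i\<in>I. e i = a}" and ?G = "\<lambda>a. {j\<in>J. d j = a}"
  have fin: "finite (?F a)" "finite (?G a)" for a
    using assms by (auto simp: finite_fibres_def)
  have "(enum_series I e v * enum_series J d w) $ n
      = (\<Sum>a=0..n. \<Sum>x\<in>?F a \<times> ?G (n - a). v (fst x) * w (snd x))"
    by (simp add: fps_mult_nth enum_series_nth sum_product sum.cartesian_product case_prod_unfold)
  also have "\<dots> = (\<Sum>x\<in>(\<Union>a\<in>{0..n}. ?F a \<times> ?G (n - a)). v (fst x) * w (snd x))"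
    using fin by (intro sum.UNION_disjoint [symmetric]) auto
  also have "(\<Union>a\<in>{0..n}. ?F a \<times> ?G (n - a)) = {x\<in>I \<times> J. (case x of (i, j) \<Rightarrow> e i + d j) = n}"
    by auto
  finally show "(enum_series I e v * enum_series J d w) $ n =
      enum_series (I \<times> J) (\<lambda>(i, j). e i + d j) (\<lambda>(i, j). v i * w j) $ n"
    by (simp add: enum_series_nth case_prod_unfold)
qed

lemma finite_fibres_Times:
  assumes "finite_fibres I e" "finite_fibres J d"
  shows "finite_fibres (I \<times> J) (\<lambda>(i, j). e i + d j)"
  unfolding finite_fibres_def
proof
  fix n
  have "{x\<in>I \<times> J. (case x of (i, j) \<Rightarrow> e i + d j) = n}
      = (\<Union>a\<in>{0..n}. {i\<in>I. e i = a} \<times> {j\<in>J. d j = n - a})"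
    by auto
  also have "finite \<dots>" using assms by (auto simp: finite_fibres_def)
  finally show "finite {x\<in>I \<times> J. (case x of (i, j) \<Rightarrow> e i + d j) = n}" .
qed

lemma fps_XD_enum_series: "fps_XD (enum_series I e w) = enum_series I e (\<lambda>i. int (e i) * w i)"
  by (rule fps_ext) (simp only: fps_XD_nth enum_series_nth sum_distrib_left, rule sum.cong, auto)

lemma fps_XD_mult: "fps_XD (f * g) = fps_XD f * g + f * fps_XD g"
  for f g :: "'a::comm_ring_1 fps"
  by (simp add: fps_XD_def algebra_simps)

lemma fps_XD_power_Suc: "fps_XD (f ^ Suc n) = of_nat (Suc n) * f ^ n * fps_XD f"
  for f :: "'a::comm_ring_1 fps"
  by (induction n) (simp_all add: fps_XD_mult algebra_simps)

lemma fps_XD_numeral_mult: "fps_XD (numeral k * f) = numeral k * fps_XD f"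
  for f :: "'a::comm_ring_1 fps"
  by (simp add: numeral_fps_const)

lemma fps_numeral_neq_0 [simp]: "(numeral n :: int fps) \<noteq> 0"
  by (simp add: numeral_fps_const)

section \<open>Gaussian binomial coefficients and the finite triple product\<close>

definition qpoch :: "'a::comm_ring_1 \<Rightarrow> nat \<Rightarrow> 'a" where
  "qpoch q m = (\<Prod>i<m. 1 - q ^ Suc i)"

lemma qpoch_0 [simp]: "qpoch q 0 = 1" and
  qpoch_Suc: "qpoch q (Suc m) = qpoch q m * (1 - q ^ Suc m)"
  by (simp_all add: qpoch_def)

text \<open>
  The infinite product of the factors \<open>1 - q^(b*i)\<close>, \<open>i \<ge> 1\<close>. For \<open>b \<ge> 1\<close> the coefficient of degree \<open>n\<close> no longer
  changes once \<open>n\<close> factors have been taken.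
\<close>
definition euler :: "nat \<Rightarrow> int fps" where
  "euler b = Abs_fps (\<lambda>n. qpoch (fps_X ^ b) n $ n)"

lemma agree_qpoch:
  assumes "b \<ge> 1" "N \<le> m"
  shows "agree_upto N (qpoch (fps_X ^ b) m) (euler b)"
proof -
  have step: "agree_upto K (qpoch (fps_X ^ b) k) (qpoch (fps_X ^ b) K)" if "K \<le> k" for k K
    using that
  proof (induction k rule: dec_induct)
    case (step k)
    have lt: "K < b * Suc k" using step.hyps assms(1)
      by (metis le_imp_less_Suc less_le_trans mult.commute mult_le_mono1 nat_mult_1_right)
    have "qpoch (fps_X ^ b) (Suc k) = qpoch (fps_X ^ b) k - qpoch (fps_X ^ b) k * fps_X ^ (b * Suc k)"
      by (simp only: qpoch_Suc power_mult [symmetric] right_diff_distrib mult_1_right)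
    then have "agree_upto K (qpoch (fps_X ^ b) (Suc k)) (qpoch (fps_X ^ b) k)"
      using agree_upto_X_power [OF lt, of "qpoch (fps_X ^ b) k"]
      unfolding agree_upto_def by (metis diff_zero fps_sub_nth fps_zero_nth)
    then show ?case using step.IH agree_upto_trans by blast
  qed simp
  show ?thesis unfolding agree_upto_def
  proof (intro allI impI)
    fix i assume "i \<le> N"
    then show "qpoch (fps_X ^ b) m $ i = euler b $ i"
      using step [of i m] assms(2) by (simp add: agree_upto_def euler_def)
  qed
qed

lemma euler_nth_0 [simp]: "euler b $ 0 = 1"
  by (simp add: euler_def)

fun gauss_binomial :: "'a::comm_ring_1 \<Rightarrow> nat \<Rightarrow> nat \<Rightarrow> 'a" where
  "gauss_binomial q n 0 = 1"
| "gauss_binomial q 0 (Suc k) = 0"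
| "gauss_binomial q (Suc n) (Suc k) = gauss_binomial q n (Suc k) + q ^ (n - k) * gauss_binomial q n k"

lemma gauss_binomial_eq_0: "n < k \<Longrightarrow> gauss_binomial q n k = 0"
  by (induction q n k rule: gauss_binomial.induct) auto

lemma gauss_binomial_self [simp]: "gauss_binomial q n n = 1"
  by (induction n) (auto simp: gauss_binomial_eq_0)

text \<open>
  The quotient formula for the Gaussian binomial in a form without division, so that it holds in every
  commutative ring and survives the passage to power series.
\<close>
lemma gauss_binomial_qpoch:
  "gauss_binomial q (k + l) k * (qpoch q k * qpoch q l) = qpoch q (k + l)"
proof (induction "k + l" arbitrary: k l rule: less_induct)
  case less
  show ?case
  proof (cases k)
    case 0
    then show ?thesis by simp
  next
    case k: (Suc k')
    show ?thesis
    proof (cases l)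
      case 0
      then show ?thesis by simp
    next
      case l: (Suc l')
      define c where "c = qpoch q (k' + l)"
      have IH1: "gauss_binomial q (k' + l) k * (qpoch q k * qpoch q l') = c"
        using less [of k l'] k l by (simp add: c_def)
      have IH2: "gauss_binomial q (k' + l) k' * (qpoch q k' * qpoch q l) = c"
        using less [of k' l] k l by (simp add: c_def)
      have "gauss_binomial q (k + l) k * (qpoch q k * qpoch q l)
          = (1 - q ^ l) * (gauss_binomial q (k' + l) k * (qpoch q k * qpoch q l'))
            + q ^ l * (1 - q ^ k) * (gauss_binomial q (k' + l) k' * (qpoch q k' * qpoch q l))"
        using k l by (simp add: qpoch_Suc algebra_simps)
      also have "\<dots> = c * (1 - q ^ (k + l))"
        unfolding IH1 IH2 by (simp add: algebra_simps power_add)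
      also have "\<dots> = qpoch q (k + l)"
        using k by (simp add: c_def qpoch_Suc)
      finally show ?thesis .
    qed
  qed
qed

text \<open>
  The homogeneous form, with \<open>y\<close> next to \<open>z\<close>, lets the triple product be centred by taking \<open>y\<close> to be a power of
  \<open>q\<close>, without negative powers.
\<close>
theorem q_binomial:
  "(\<Prod>i<n. y + z * q ^ i) = (\<Sum>k\<le>n. gauss_binomial q n k * q ^ (k choose 2) * z ^ k * y ^ (n - k))"
proof (induction n)
  case 0
  then show ?case by (simp add: binomial_eq_0)
next
  case (Suc n)
  let ?t = "\<lambda>k. gauss_binomial q n k * q ^ (k choose 2) * z ^ k"
  have "(\<Sum>k\<le>Suc n. gauss_binomial q (Suc n) k * q ^ (k choose 2) * z ^ k * y ^ (Suc n - k))
      = y ^ Suc n + (\<Sum>k\<le>n. gauss_binomial q (Suc n) (Suc k) * q ^ (Suc k choose 2) * z ^ Suc k * y ^ (n - k))"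
    by (subst sum.atMost_Suc_shift) (simp add: binomial_eq_0)
  also have "(\<Sum>k\<le>n. gauss_binomial q (Suc n) (Suc k) * q ^ (Suc k choose 2) * z ^ Suc k * y ^ (n - k))
      = (\<Sum>k\<le>n. ?t (Suc k) * y ^ (n - k)) + (\<Sum>k\<le>n. ?t k * y ^ (n - k)) * (z * q ^ n)"
    unfolding sum_distrib_right sum.distrib [symmetric]
  proof (rule sum.cong)
    fix k assume "k \<in> {..n}"
    then have "q ^ n = q ^ (n - k) * q ^ k" by (simp flip: power_add)
    moreover have "Suc k choose 2 = k + (k choose 2)" by (simp add: numeral_2_eq_2)
    ultimately show "gauss_binomial q (Suc n) (Suc k) * q ^ (Suc k choose 2) * z ^ Suc k * y ^ (n - k)
      = ?t (Suc k) * y ^ (n - k) + ?t k * y ^ (n - k) * (z * q ^ n)"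
      by (simp add: algebra_simps power_add)
  qed simp
  also have "y ^ Suc n + ((\<Sum>k\<le>n. ?t (Suc k) * y ^ (n - k)) + (\<Sum>k\<le>n. ?t k * y ^ (n - k)) * (z * q ^ n))
     = (\<Sum>k\<le>Suc n. ?t k * y ^ (Suc n - k)) + (\<Sum>k\<le>n. ?t k * y ^ (n - k)) * (z * q ^ n)"
    by (subst sum.atMost_Suc_shift) (simp add: binomial_eq_0)
  also have "(\<Sum>k\<le>Suc n. ?t k * y ^ (Suc n - k)) = (\<Sum>k\<le>n. ?t k * y ^ (n - k)) * y"
    by (simp add: gauss_binomial_eq_0 sum_distrib_right sum_distrib_left Suc_diff_le algebra_simps)
  finally show ?case using Suc.IH by (simp add: algebra_simps)
qed

definition tri :: "int \<Rightarrow> nat" where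
  "tri j = nat (j * (j - 1) div 2)"

definition pent :: "int \<Rightarrow> nat" where
  "pent k = nat (k * (3 * k + 1) div 2)"

text \<open>
  This is \<open>(-1)^j\<close> for an integer \<open>j\<close> of either sign.
\<close>
definition parity_sign :: "int \<Rightarrow> int" where
  "parity_sign j = (if even j then 1 else -1)"

lemma int_tri: "2 * int (tri j) = j * (j - 1)"
proof -
  have "j * (j - 1) \<ge> 0" by (cases "j \<ge> 1") (auto intro: mult_nonneg_nonneg mult_nonpos_nonpos)
  moreover have "even (j * (j - 1))" by auto
  ultimately show ?thesis by (simp add: tri_def)
qed

lemma int_pent: "2 * int (pent k) = k * (3 * k + 1)"
proof -
  have "k * (3 * k + 1) \<ge> 0" by (cases "k \<ge> 0") (auto intro: mult_nonneg_nonneg mult_nonpos_nonpos)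
  moreover have "even (k * (3 * k + 1))" by auto
  ultimately show ?thesis by (simp add: pent_def)
qed

lemma abs_le_tri: "\<bar>j\<bar> \<le> int (tri j) + 1"
proof -
  have "2 * \<bar>j\<bar> \<le> j * (j - 1) + 2"
  proof (cases "j \<ge> 1")
    case True
    then have "(j - 1) * (j - 2) \<ge> 0" by (cases "j = 1") (auto intro: mult_nonneg_nonneg)
    with True show ?thesis by (simp add: algebra_simps)
  next
    case False
    then have "j * (j + 1) \<ge> 0" by (cases "j = 0") (auto intro: mult_nonpos_nonpos)
    with False show ?thesis by (simp add: algebra_simps)
  qed
  then show ?thesis using int_tri [of j] by linarith
qed

lemma abs_le_pent: "\<bar>k\<bar> \<le> int (pent k)"
proof -
  have "2 * \<bar>k\<bar> \<le> k * (3 * k + 1)"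
  proof (cases "k \<ge> 0")
    case True
    then have "k * (3 * k - 1) \<ge> 0" by (cases "k = 0") (auto intro: mult_nonneg_nonneg)
    with True show ?thesis by (simp add: algebra_simps)
  next
    case False
    then have "k * (3 * k + 3) \<ge> 0" by (auto intro: mult_nonpos_nonpos)
    with False show ?thesis by (simp add: algebra_simps)
  qed
  then show ?thesis using int_pent [of k] by linarith
qed

lemma parity_sign_shift: "parity_sign (int k - int n) = (-1) ^ n * (-1) ^ k"
  by (auto simp: parity_sign_def minus_one_power_iff)

text \<open>
  This is MacMahon's finite form of Jacobi's triple product, multiplied by \<open>z^n\<close>. It is the \<open>q\<close>-binomial
  theorem for \<open>2 * n\<close> factors with \<open>y = q^n\<close>: taking out the powers of \<open>q\<close> turns the first \<open>n\<close> factors into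
  \<open>z + q^(n - i)\<close> and the last \<open>n\<close> into \<open>1 + z * q^i\<close>. Division by the common power of \<open>q\<close> needs an integral domain.
\<close>
theorem finite_triple_product:
  fixes q z :: "'a::idom"
  assumes "q \<noteq> 0"
  shows "(\<Prod>i<n. z + q ^ Suc i) * (\<Prod>i<n. 1 + z * q ^ i) =
         (\<Sum>k\<le>2 * n. gauss_binomial q (2 * n) k * q ^ tri (int k - int n) * z ^ k)"
proof -
  let ?c = "n * n + (n choose 2)"
  have prod_split: "(\<Prod>i<m + l. f i) = (\<Prod>i<m. f i) * (\<Prod>i<l. f (m + i))" for f :: "nat \<Rightarrow> 'a" and m l
    by (induction l) (simp_all add: mult_ac)
  have "q ^ ?c * ((\<Prod>i<n. z + q ^ Suc i) * (\<Prod>i<n. 1 + z * q ^ i)) = (\<Prod>i<2 * n. q ^ n + z * q ^ i)"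
  proof -
    have "(\<Prod>i<2 * n. q ^ n + z * q ^ i) = (\<Prod>i<n. q ^ n + z * q ^ i) * (\<Prod>i<n. q ^ n + z * q ^ (n + i))"
      using prod_split [of "\<lambda>i. q ^ n + z * q ^ i" n n] by (simp only: mult_2)
    also have "(\<Prod>i<n. q ^ n + z * q ^ i) = (\<Prod>i<n. q ^ i * (z + q ^ (n - i)))"
      by (intro prod.cong) (simp_all add: algebra_simps flip: power_add)
    also have "\<dots> = q ^ (n choose 2) * (\<Prod>i<n. z + q ^ (n - i))"
      by (simp add: prod.distrib gauss_sum_nat choose_two flip: power_sum)
        (simp add: lessThan_atLeast0 Sum_Ico_nat)
    also have "(\<Prod>i<n. z + q ^ (n - i)) = (\<Prod>i<n. z + q ^ Suc i)"
      by (rule prod.reindex_bij_witness [where i = "\<lambda>i. n - Suc i" and j = "\<lambda>i. n - Suc i"])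
        (auto simp: Suc_diff_Suc)
    also have "(\<Prod>i<n. q ^ n + z * q ^ (n + i)) = (\<Prod>i<n. q ^ n * (1 + z * q ^ i))"
      by (intro prod.cong) (simp_all add: algebra_simps power_add)
    also have "\<dots> = q ^ (n * n) * (\<Prod>i<n. 1 + z * q ^ i)"
      by (simp add: prod.distrib power_mult)
    finally show ?thesis by (simp add: power_add)
  qed
  also have "\<dots> = (\<Sum>k\<le>2 * n. gauss_binomial q (2 * n) k * q ^ (k choose 2) * z ^ k * (q ^ n) ^ (2 * n - k))"
    by (rule q_binomial)
  also have "\<dots> = q ^ ?c * (\<Sum>k\<le>2 * n. gauss_binomial q (2 * n) k * q ^ tri (int k - int n) * z ^ k)"
    unfolding sum_distrib_left
  proof (rule sum.cong)
    fix k assume k: "k \<in> {..2 * n}"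
    have choose: "2 * int (m choose 2) = int m * (int m - 1)" for m
      by (induction m) (auto simp: choose_two binomial_eq_0 numeral_2_eq_2 algebra_simps)
    have "int (n * (2 * n - k)) = int n * (2 * int n - int k)"
      using k by (simp add: of_nat_diff)
    then have "int ((k choose 2) + n * (2 * n - k)) = int (?c + tri (int k - int n))"
      using choose [of k] choose [of n] int_tri [of "int k - int n"]
      unfolding of_nat_add of_nat_mult by (simp add: algebra_simps)
    then have "q ^ (k choose 2) * (q ^ n) ^ (2 * n - k) = q ^ ?c * q ^ tri (int k - int n)"
      unfolding power_mult [symmetric] power_add [symmetric] by (simp only: of_nat_eq_iff)
    then show "gauss_binomial q (2 * n) k * q ^ (k choose 2) * z ^ k * (q ^ n) ^ (2 * n - k)
      = q ^ ?c * (gauss_binomial q (2 * n) k * q ^ tri (int k - int n) * z ^ k)"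
      by (simp add: mult_ac)
  qed simp
  finally show ?thesis using assms by simp
qed

section \<open>Theta series as limits of finite sums\<close>

lemma finite_fibres_int:
  assumes "\<And>j::int. \<bar>j\<bar> \<le> int (e j) + 1"
  shows "finite_fibres UNIV e"
  unfolding finite_fibres_def
proof
  fix n
  have "{i \<in> UNIV. e i = n} \<subseteq> {- int n - 1..int n + 1}"
  proof
    fix i assume "i \<in> {i \<in> UNIV. e i = n}"
    then show "i \<in> {- int n - 1..int n + 1}" using assms [of i] by auto
  qed
  then show "finite {i \<in> UNIV. e i = n}" by (rule finite_subset) simp
qed

lemma finite_fibres_tri: "finite_fibres UNIV (\<lambda>j. b * tri j)" if "b \<ge> 1"
proof (rule finite_fibres_int)
  show "\<bar>j\<bar> \<le> int (b * tri j) + 1" for j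
    using abs_le_tri [of j] mult_right_mono [of 1 "int b" "int (tri j)"] that by simp
qed

lemma finite_fibres_pent: "finite_fibres UNIV (\<lambda>j. b * pent j)" if "b \<ge> 1"
proof (rule finite_fibres_int)
  show "\<bar>j\<bar> \<le> int (b * pent j) + 1" for j
    using abs_le_pent [of j] mult_right_mono [of 1 "int b" "int (pent j)"] that by simp
qed

text \<open>
  In the quotient formula numerator and denominator are products that tend to \<open>euler b\<close>, one in the numerator
  against two in the denominator; so the Gaussian binomial tends to \<open>1 / euler b\<close> when both its ends
  grow.
\<close>
lemma agree_gauss_binomial:
  assumes "b \<ge> 1" "N \<le> k" "N \<le> l"
  shows "agree_upto N (euler b * gauss_binomial (fps_X ^ b) (k + l) k) 1"
proof -
  let ?Q = "fps_X ^ b :: int fps"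
  have eq: "agree_upto N (qpoch ?Q m) (euler b)" if "N \<le> m" for m
    using agree_qpoch [of b N m] assms that by simp
  have "agree_upto N (euler b * (euler b * gauss_binomial ?Q (k + l) k))
                     (qpoch ?Q k * (qpoch ?Q l * gauss_binomial ?Q (k + l) k))"
    using assms by (intro agree_upto_mult agree_upto_refl agree_upto_sym [OF eq])
  also have "qpoch ?Q k * (qpoch ?Q l * gauss_binomial ?Q (k + l) k) = qpoch ?Q (k + l)"
    using gauss_binomial_qpoch [of ?Q k l] by (simp add: mult_ac)
  also have "agree_upto N \<dots> (euler b * 1)"
    using eq [of "k + l"] assms by simp
  finally show ?thesis by (rule agree_upto_cancel) simp
qed

text \<open>
  The growth condition on \<open>e\<close> keeps the terms that matter in degree at most \<open>N\<close> within distance \<open>N + 1\<close> of the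
  centre. There, by \<open>n \<ge> 2 * N + 1\<close>, both ends of the Gaussian binomial are at least \<open>N\<close>, so
  \<open>euler b\<close> cancels it.
\<close>
theorem agree_theta_series:
  assumes "b \<ge> 1" "n \<ge> 2 * N + 1" and e: "\<And>j. \<bar>j\<bar> \<le> int (e j) + 1"
  shows "agree_upto N
     (euler b * (\<Sum>k\<le>2 * n. gauss_binomial (fps_X ^ b) (2 * n) k * fps_X ^ e (int k - int n)
                              * fps_const (w (int k - int n))))
     (enum_series UNIV e w)"
proof -
  let ?j = "\<lambda>k. int k - int n"
  have summand: "agree_upto N (euler b * (gauss_binomial (fps_X ^ b) (2 * n) k * fps_X ^ e (?j k) * fps_const (w (?j k))))
      (fps_const (w (?j k)) * fps_X ^ e (?j k))" if "k \<le> 2 * n" for k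
  proof (cases "e (?j k) \<le> N")
    case True
    then have "\<bar>?j k\<bar> \<le> int N + 1" using e [of "?j k"] by linarith
    then have "N \<le> k" "N \<le> 2 * n - k" using assms(2) that by linarith+
    then have "agree_upto N (euler b * gauss_binomial (fps_X ^ b) (2 * n) k) 1"
      using agree_gauss_binomial [of b N k "2 * n - k"] assms(1) that by simp
    then have "agree_upto N ((euler b * gauss_binomial (fps_X ^ b) (2 * n) k) * (fps_X ^ e (?j k) * fps_const (w (?j k))))
        (1 * (fps_X ^ e (?j k) * fps_const (w (?j k))))"
      by (intro agree_upto_mult agree_upto_refl)
    then show ?thesis by (simp add: mult_ac)
  next
    case False
    then have lt: "N < e (?j k)" by simp
    show ?thesis
      using agree_upto_X_power [OF lt, of "euler b * gauss_binomial (fps_X ^ b) (2 * n) k * fps_const (w (?j k))"]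
        agree_upto_X_power [OF lt, of "fps_const (w (?j k))"]
      by (simp add: agree_upto_def mult_ac)
  qed
  have "agree_upto N
     (euler b * (\<Sum>k\<le>2 * n. gauss_binomial (fps_X ^ b) (2 * n) k * fps_X ^ e (?j k) * fps_const (w (?j k))))
     (\<Sum>k\<le>2 * n. fps_const (w (?j k)) * fps_X ^ e (?j k))"
    unfolding sum_distrib_left by (intro agree_upto_sum summand) simp
  also have "agree_upto N (\<Sum>k\<le>2 * n. fps_const (w (?j k)) * fps_X ^ e (?j k)) (enum_series UNIV e w)"
    unfolding agree_upto_def
  proof (intro allI impI)
    fix i assume i: "i \<le> N"
    have "(\<Sum>k\<le>2 * n. fps_const (w (?j k)) * fps_X ^ e (?j k)) $ i
        = (\<Sum>k\<le>2 * n. if e (?j k) = i then w (?j k) else 0)"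
      by (simp add: fps_sum_nth if_distrib eq_commute cong: if_cong)
    also have "\<dots> = (\<Sum>k\<in>{k. k \<le> 2 * n \<and> e (?j k) = i}. w (?j k))"
      by (simp add: sum.inter_filter [symmetric] atMost_def)
    also have "\<dots> = (\<Sum>j\<in>{j\<in>UNIV. e j = i}. w j)"
    proof (rule sum.reindex_bij_witness [where i = "\<lambda>j. nat (j + int n)" and j = ?j])
      fix j assume "j \<in> {j\<in>UNIV. e j = i}"
      then have "\<bar>j\<bar> \<le> int N + 1" using e [of j] i by auto
      then have "- int n \<le> j" "j \<le> int n" using assms(2) by linarith+
      then show "?j (nat (j + int n)) = j" "nat (j + int n) \<in> {k. k \<le> 2 * n \<and> e (?j k) = i}"
        using \<open>j \<in> _\<close> by auto
    qed auto
    finally show "(\<Sum>k\<le>2 * n. fps_const (w (?j k)) * fps_X ^ e (?j k)) $ i = enum_series UNIV e w $ i"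
      by (simp add: enum_series_nth)
  qed
  finally show ?thesis .
qed

section \<open>Product formulas for three theta series\<close>

lemma fps_const_eq_of_int: "fps_const (c :: int) = of_int c"
  by (simp flip: fps_of_int)

text \<open>
  The triple product at \<open>z = 1\<close>. The factor 2 on the right comes from the factor \<open>1 + q^0\<close>; correspondingly the
  series over all integers is twice Gauss's series over the triangular numbers.
\<close>
theorem triangular_series_eq:
  "enum_series UNIV tri (\<lambda>_. 1) * euler 1 = 2 * euler 2 ^ 2"
proof (rule agree_upto_eqI)
  fix N :: nat
  let ?T = "enum_series UNIV tri (\<lambda>_. 1)"
  let ?n = "2 * N + 1"
  define Y where "Y = (\<Prod>i<?n. 1 + fps_X ^ Suc i :: int fps)"
  \<comment> \<open>Of the two products for \<open>z = 1\<close>, the second starts with \<open>1 + q^0 = 2\<close>, which leaves \<open>2 * N\<close> factors for \<open>Z\<close>.\<close>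
  define Z where "Z = (\<Prod>i<2 * N. 1 + fps_X ^ Suc i :: int fps)"
  have sq: "(\<Prod>i<m. 1 + fps_X ^ Suc i) * qpoch fps_X m = qpoch (fps_X ^ 2 :: int fps) m" for m
    by (simp add: qpoch_def algebra_simps flip: prod.distrib power_mult power_add) (simp add: mult_2_right)
  have q1: "agree_upto N (qpoch fps_X m) (euler 1)" if "N \<le> m" for m
    using agree_qpoch [of 1 N m] that by simp
  have q2: "agree_upto N (qpoch (fps_X ^ 2) m) (euler 2)" if "N \<le> m" for m
    using agree_qpoch [of 2 N m] that by simp
  have lim: "agree_upto N ((\<Prod>i<m. 1 + fps_X ^ Suc i) * euler 1) (euler 2)" if "N \<le> m" for m
  proof -
    have "agree_upto N ((\<Prod>i<m. 1 + fps_X ^ Suc i) * euler 1) ((\<Prod>i<m. 1 + fps_X ^ Suc i) * qpoch fps_X m)"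
      using that by (intro agree_upto_mult agree_upto_refl agree_upto_sym [OF q1])
    then show ?thesis unfolding sq using q2 [OF that] agree_upto_trans by blast
  qed
  have "(\<Prod>i<?n. 1 + fps_X ^ i :: int fps) = 2 * Z"
    unfolding Z_def by (simp add: prod.lessThan_Suc_shift del: prod.lessThan_Suc)
  then have "(\<Sum>k\<le>2 * ?n. gauss_binomial fps_X (2 * ?n) k * fps_X ^ tri (int k - int ?n)) = Y * (2 * Z)"
    using finite_triple_product [of "fps_X :: int fps" 1 ?n] by (simp add: Y_def)
  then have "agree_upto N (euler 1 * (Y * (2 * Z))) ?T"
    using agree_theta_series [of 1 N ?n tri "\<lambda>_. 1"] abs_le_tri by simp
  then have "agree_upto N (?T * euler 1) (euler 1 * (Y * (2 * Z)) * euler 1)"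
    by (rule agree_upto_mult [OF agree_upto_sym agree_upto_refl])
  also have "\<dots> = 2 * ((Y * euler 1) * (Z * euler 1))" by (simp add: mult_ac)
  also have "agree_upto N \<dots> (2 * (euler 2 * euler 2))"
    unfolding Y_def Z_def by (intro agree_upto_mult agree_upto_refl lim) auto
  finally show "agree_upto N (?T * euler 1) (2 * euler 2 ^ 2)"
    by (simp add: power2_eq_square)
qed

text \<open>
  Euler's pentagonal number theorem, from the triple product at \<open>z = - q^2\<close> with base \<open>q^3\<close>: its two products
  and the product of the \<open>1 - q^(3*i)\<close> together run through all residue classes modulo 3.
\<close>
theorem euler_pentagonal:
  assumes "b \<ge> 1"
  shows "euler b = enum_series UNIV (\<lambda>k. b * pent k) parity_sign"
proof (rule agree_upto_eqI)
  fix N :: nat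
  let ?n = "2 * N + 1"
  let ?q = "fps_X ^ b :: int fps"
  define H where "H = (\<Prod>i<?n. 1 - ?q ^ (3 * i + 1)) * (\<Prod>i<?n. 1 - ?q ^ (3 * i + 2))"
  have finite: "(\<Sum>k\<le>2 * n. gauss_binomial (q ^ 3) (2 * n) k * q ^ pent (int k - int n)
                         * of_int (parity_sign (int k - int n)))
       = (\<Prod>i<n. 1 - q ^ (3 * i + 1)) * (\<Prod>i<n. 1 - q ^ (3 * i + 2))"
    (is "?S = ?P") if "q \<noteq> 0" for q :: "int fps" and n
  proof -
    have "(- 1) ^ n * q ^ (2 * n) * ?P = (\<Prod>i<n. - (q ^ 2) + (q ^ 3) ^ Suc i) * (\<Prod>i<n. 1 + - (q ^ 2) * (q ^ 3) ^ i)"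
    proof -
      have "(\<Prod>i<n. - (q ^ 2) + (q ^ 3) ^ Suc i) = (\<Prod>i<n. - (q ^ 2) * (1 - q ^ (3 * i + 1)))"
      proof (rule prod.cong)
        fix i
        have "(q ^ 3) ^ Suc i = q ^ 2 * q ^ (3 * i + 1)"
          unfolding power_mult [symmetric] power_add [symmetric]
          by (rule arg_cong [of _ _ "\<lambda>e. q ^ e"]) simp
        then show "- (q ^ 2) + (q ^ 3) ^ Suc i = - (q ^ 2) * (1 - q ^ (3 * i + 1))"
          by (simp only: right_diff_distrib) simp
      qed simp
      moreover have "(\<Prod>i<n. 1 + - (q ^ 2) * (q ^ 3) ^ i) = (\<Prod>i<n. 1 - q ^ (3 * i + 2))"
        by (intro prod.cong) (simp_all add: power_add power2_eq_square mult.commute flip: power_mult)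
      moreover have "(- (q ^ 2)) ^ n = (- 1) ^ n * q ^ (2 * n)"
        by (simp add: power_minus [of "q ^ 2"] flip: power_mult)
      ultimately show ?thesis
        by (simp only: prod.distrib prod_constant card_lessThan mult_ac)
    qed
    also have "\<dots> = (\<Sum>k\<le>2 * n. gauss_binomial (q ^ 3) (2 * n) k * (q ^ 3) ^ tri (int k - int n) * (- (q ^ 2)) ^ k)"
      by (rule finite_triple_product) (use that in simp)
    also have "\<dots> = (- 1) ^ n * q ^ (2 * n) * ?S"
      unfolding sum_distrib_left
    proof (rule sum.cong)
      fix k
      have "int (3 * tri (int k - int n) + 2 * k) = int (2 * n + pent (int k - int n))"
        using int_tri [of "int k - int n"] int_pent [of "int k - int n"] by (simp add: algebra_simps)
      then have exponents: "(q ^ 3) ^ tri (int k - int n) * q ^ (2 * k) = q ^ (2 * n) * q ^ pent (int k - int n)"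
        unfolding power_mult [symmetric] power_add [symmetric] by (simp only: of_nat_eq_iff)
      have power: "(- (q ^ 2)) ^ k = (-1) ^ k * q ^ (2 * k)"
        by (simp add: power_minus [of "q ^ 2"] flip: power_mult)
      have sign: "(- 1 :: int fps) ^ n * of_int (parity_sign (int k - int n)) = (-1) ^ k"
        unfolding parity_sign_shift by (simp flip: power_mult_distrib mult.assoc)
      have "gauss_binomial (q ^ 3) (2 * n) k * (q ^ 3) ^ tri (int k - int n) * (- (q ^ 2)) ^ k
          = (-1) ^ k * (gauss_binomial (q ^ 3) (2 * n) k * ((q ^ 3) ^ tri (int k - int n) * q ^ (2 * k)))"
        unfolding power by (simp only: mult_ac)
      also have "\<dots> = (- 1) ^ n * q ^ (2 * n) * (gauss_binomial (q ^ 3) (2 * n) k * q ^ pent (int k - int n)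
                         * of_int (parity_sign (int k - int n)))"
        unfolding exponents sign [symmetric] by (simp only: mult_ac)
      finally show "gauss_binomial (q ^ 3) (2 * n) k * (q ^ 3) ^ tri (int k - int n) * (- (q ^ 2)) ^ k
          = (- 1) ^ n * q ^ (2 * n) * (gauss_binomial (q ^ 3) (2 * n) k * q ^ pent (int k - int n)
                         * of_int (parity_sign (int k - int n)))" .
    qed simp
    finally show ?thesis using that by simp
  qed
  have thirds: "qpoch (q ^ 3) n * ((\<Prod>i<n. 1 - q ^ (3 * i + 1)) * (\<Prod>i<n. 1 - q ^ (3 * i + 2))) = qpoch q (3 * n)"
    for q :: "int fps" and n
  proof (induction n)
    case (Suc n)
    let ?new = "(1 - q ^ (3 * n + 1)) * (1 - q ^ (3 * n + 2)) * (1 - q ^ (3 * Suc n))"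
    have "qpoch (q ^ 3) (Suc n) = qpoch (q ^ 3) n * (1 - q ^ (3 * Suc n))"
      by (simp only: qpoch_Suc power_mult)
    then have "qpoch (q ^ 3) (Suc n) * ((\<Prod>i<Suc n. 1 - q ^ (3 * i + 1)) * (\<Prod>i<Suc n. 1 - q ^ (3 * i + 2)))
      = (qpoch (q ^ 3) n * ((\<Prod>i<n. 1 - q ^ (3 * i + 1)) * (\<Prod>i<n. 1 - q ^ (3 * i + 2)))) * ?new"
      by (simp only: prod.lessThan_Suc mult_ac)
    also have "\<dots> = qpoch q (3 * n) * ?new"
      by (simp only: Suc.IH)
    also have "\<dots> = qpoch q (3 * Suc n)"
      by (simp add: numeral_3_eq_3 qpoch_Suc mult_ac)
    finally show ?case .
  qed simp
  have "(\<Sum>k\<le>2 * ?n. gauss_binomial (fps_X ^ (3 * b)) (2 * ?n) k * fps_X ^ (b * pent (int k - int ?n))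
           * fps_const (parity_sign (int k - int ?n))) = H"
    using finite [of ?q ?n] unfolding H_def
    by (simp only: fps_const_eq_of_int power_mult [symmetric] mult.commute [of b] fps_X_neq_zero power_eq_0_iff simp_thms)
  moreover have "\<bar>j\<bar> \<le> int (b * pent j) + 1" for j
    using abs_le_pent [of j] mult_right_mono [of 1 "int b" "int (pent j)"] assms by simp
  ultimately have theta: "agree_upto N (euler (3 * b) * H) (enum_series UNIV (\<lambda>k. b * pent k) parity_sign)"
    using agree_theta_series [of "3 * b" N ?n "\<lambda>k. b * pent k" parity_sign] assms by simp
  have "agree_upto N (euler b) (qpoch ?q (3 * ?n))"
    using assms by (intro agree_upto_sym [OF agree_qpoch]) auto
  also have "qpoch ?q (3 * ?n) = qpoch (fps_X ^ (3 * b)) ?n * H"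
    using thirds [of ?q ?n] by (simp add: H_def mult.commute [of 3] flip: power_mult)
  also have "agree_upto N \<dots> (euler (3 * b) * H)"
    using assms by (intro agree_upto_mult agree_upto_refl agree_qpoch) auto
  also note theta
  finally show "agree_upto N (euler b) (enum_series UNIV (\<lambda>k. b * pent k) parity_sign)" .
qed

text \<open>
  The finite triple product, as a polynomial in \<open>z\<close>, has the factor \<open>1 + z\<close>, so it vanishes at \<open>z = - 1\<close> and its
  derivative there is the value of the remaining factors. On the side of the sum the derivative produces
  the weights \<open>k\<close>; the vanishing of the sum itself allows them to be replaced by any affine function of \<open>k\<close>,
  and \<open>2 * j - 1\<close> is the one that matches the symmetry \<open>j \<mapsto> 1 - j\<close> of the exponents.
\<close>
lemma finite_jacobi:
  fixes q :: "'a::idom"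
  assumes "q \<noteq> 0"
  shows "(\<Sum>k\<le>2 * Suc n. gauss_binomial q (2 * Suc n) k * q ^ tri (int k - int (Suc n))
            * of_int (- parity_sign (int k - int (Suc n)) * (2 * (int k - int (Suc n)) - 1)))
       = 2 * (qpoch q (Suc n) * qpoch q n)"
proof -
  let ?m = "Suc n"
  define c where "c k = gauss_binomial q (2 * ?m) k * q ^ tri (int k - int ?m)" for k
  define R where "R = (\<Prod>i<?m. [:q ^ Suc i, 1:]) * (\<Prod>i<n. [:1, q ^ Suc i:])"
  have gauss: "gauss_binomial [:q:] a k = [:gauss_binomial q a k:]" for a k
    by (induction q a k rule: gauss_binomial.induct) (simp_all add: poly_const_pow)
  have "[:1, 1:] * R = (\<Prod>i<?m. [:0, 1:] + [:q:] ^ Suc i) * (\<Prod>i<?m. 1 + [:0, 1:] * [:q:] ^ i)"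
  proof -
    have "[:0, 1:] + [:q:] ^ Suc i = [:q ^ Suc i, 1:]" "1 + [:0, 1:] * [:q:] ^ i = [:1, q ^ i:]" for i
      by (simp_all add: poly_const_pow one_pCons)
    then show ?thesis
      by (simp only: R_def prod.lessThan_Suc_shift [of "\<lambda>i. [:1, q ^ i:]"] power_0 mult_ac)
  qed
  also have "\<dots> = (\<Sum>k\<le>2 * ?m. gauss_binomial [:q:] (2 * ?m) k * [:q:] ^ tri (int k - int ?m) * [:0, 1:] ^ k)"
    by (rule finite_triple_product) (use assms in simp)
  also have "\<dots> = (\<Sum>k\<le>2 * ?m. monom (c k) k)"
    by (intro sum.cong) (simp_all add: gauss c_def monom_altdef poly_const_pow mult_ac)
  finally have eq: "[:1, 1:] * R = (\<Sum>k\<le>2 * ?m. monom (c k) k)" .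
  have pderiv_sum: "pderiv (sum f A) = (\<Sum>i\<in>A. pderiv (f i))" for f :: "nat \<Rightarrow> 'a poly" and A
    by (induction A rule: infinite_finite_induct) (auto simp: pderiv_add)
  \<comment> \<open>The value and the derivative of both sides at \<open>z = - 1\<close>.\<close>
  have zero: "(\<Sum>k\<le>2 * ?m. c k * (-1) ^ k) = 0"
    using arg_cong [OF eq, of "\<lambda>p. poly p (-1)"] by (simp add: poly_sum poly_monom del: sum.atMost_Suc)
  have "poly R (-1) = poly (pderiv ([:1, 1:] * R)) (-1)"
    by (simp only: pderiv_mult) (simp add: pderiv_pCons)
  also have "\<dots> = (\<Sum>k\<le>2 * ?m. of_nat k * c k * (-1) ^ (k - 1))"
    unfolding eq by (simp add: pderiv_sum pderiv_monom poly_sum poly_monom del: sum.atMost_Suc)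
  also have "\<dots> = - (\<Sum>k\<le>2 * ?m. of_nat k * c k * (-1) ^ k)"
    unfolding sum_negf [symmetric]
  proof (rule sum.cong)
    fix k show "of_nat k * c k * (-1) ^ (k - 1) = - (of_nat k * c k * (-1) ^ k)"
      by (cases k) simp_all
  qed simp
  finally have deriv: "(\<Sum>k\<le>2 * ?m. of_nat k * c k * (-1) ^ k) = - poly R (-1)" by simp
  have R: "poly R (-1) = (-1) ^ ?m * (qpoch q ?m * qpoch q n)"
  proof -
    have "(\<Prod>i<?m. q ^ Suc i - 1) = (\<Prod>i<?m. - 1 * (1 - q ^ Suc i))" by simp
    also have "\<dots> = (- 1) ^ ?m * qpoch q ?m"
      by (simp only: prod.distrib prod_constant card_lessThan qpoch_def)
    finally show ?thesis unfolding R_def poly_mult poly_prod by (simp add: qpoch_def algebra_simps del: prod.lessThan_Suc)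
  qed
  have "(\<Sum>k\<le>2 * ?m. c k * of_int (- parity_sign (int k - int ?m) * (2 * (int k - int ?m) - 1)))
     = (\<Sum>k\<le>2 * ?m. - 2 * (-1) ^ ?m * (of_nat k * c k * (-1) ^ k) + (2 * of_nat ?m + 1) * (-1) ^ ?m * (c k * (-1) ^ k))"
    by (intro sum.cong) (simp_all only: parity_sign_shift, simp_all add: algebra_simps)
  also have "\<dots> = - 2 * (-1) ^ ?m * - poly R (-1) + (2 * of_nat ?m + 1) * (-1) ^ ?m * 0"
    by (simp only: sum.distrib sum_distrib_left [symmetric] zero deriv)
  also have "\<dots> = 2 * (qpoch q ?m * qpoch q n)"
    unfolding R by (simp flip: power_mult_distrib mult.assoc)
  finally show ?thesis by (simp only: c_def)
qed

text \<open>
  Jacobi's identity. The usual sum over natural numbers is half of the sum over all integers, in which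
  each exponent occurs for \<open>j\<close> and for \<open>1 - j\<close> with equal weights.
\<close>
theorem jacobi_euler_cube:
  assumes "b \<ge> 1"
  shows "2 * euler b ^ 3 = enum_series UNIV (\<lambda>j. b * tri j) (\<lambda>j. - parity_sign j * (2 * j - 1))"
    (is "_ = ?J")
proof (rule agree_upto_eqI)
  fix N :: nat
  let ?n = "2 * N + 1"
  let ?q = "fps_X ^ b :: int fps"
  have "(\<Sum>k\<le>2 * ?n. gauss_binomial ?q (2 * ?n) k * fps_X ^ (b * tri (int k - int ?n))
           * fps_const (- parity_sign (int k - int ?n) * (2 * (int k - int ?n) - 1)))
      = 2 * (qpoch ?q ?n * qpoch ?q (2 * N))"
    using finite_jacobi [of ?q "2 * N"]
    by (simp only: fps_const_eq_of_int power_mult Suc_eq_plus1 fps_X_neq_zero power_eq_0_iff simp_thms)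
  moreover have "\<bar>j\<bar> \<le> int (b * tri j) + 1" for j
    using abs_le_tri [of j] mult_right_mono [of 1 "int b" "int (tri j)"] assms by simp
  ultimately have "agree_upto N (euler b * (2 * (qpoch ?q ?n * qpoch ?q (2 * N)))) ?J"
    using agree_theta_series [of b N ?n "\<lambda>k. b * tri k" "\<lambda>j. - parity_sign j * (2 * j - 1)"] assms by simp
  moreover have "agree_upto N (2 * euler b ^ 3) (euler b * (2 * (qpoch ?q ?n * qpoch ?q (2 * N))))"
  proof -
    have "2 * euler b ^ 3 = euler b * (2 * (euler b * euler b))"
      by (simp add: power3_eq_cube)
    also have "agree_upto N \<dots> (euler b * (2 * (qpoch ?q ?n * qpoch ?q (2 * N))))"
      using assms by (intro agree_upto_mult agree_upto_refl agree_upto_sym [OF agree_qpoch]) auto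
    finally show ?thesis .
  qed
  ultimately show "agree_upto N (2 * euler b ^ 3) ?J"
    using agree_upto_trans by blast
qed

section \<open>A theta series equal to a quotient of Euler products\<close>

definition weighted_pentagonal :: "int fps" where
  "weighted_pentagonal = enum_series UNIV pent (\<lambda>k. 6 * k + 1)"

text \<open>
  Put \<open>y = 6*k + 1\<close> and \<open>x = 2*m - 1\<close>. The exponent of \<open>(k, m)\<close> is \<open>(y^2 + 3*x^2 - 4) / 24\<close>, so both sides are sums over
  Eisenstein integers \<open>(y + x * sqrt (-3)) / 2\<close> of given norm. Multiplication by a cube root of unity preserves
  the norm and the residue of \<open>y\<close> modulo 3, and among the three elements of an orbit exactly one has \<open>x\<close> and
  \<open>y\<close> even. The map \<open>t\<close> links the other two: it sends \<open>(y, x)\<close> to \<open>(- (3*x + y) / 2, (y - x) / 2)\<close>, from the pairs with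
  \<open>m + k\<close> even onto those with \<open>m + k\<close> odd. On each linked pair the two sides contribute the same amount:
  the weights \<open>y\<close> add up to \<open>y - (3*x + y) / 2\<close>, and the weights on the right, which are \<open>- x\<close> for even and \<open>x\<close> for odd
  \<open>m + k\<close>, add up to \<open>- x + (y - x) / 2\<close>; both are \<open>(y - 3*x) / 2\<close>.
\<close>
theorem weighted_pentagonal_mult_triangular:
  "weighted_pentagonal * enum_series UNIV tri (\<lambda>_. 1) =
   enum_series UNIV pent parity_sign * enum_series UNIV tri (\<lambda>j. - parity_sign j * (2 * j - 1))"
proof (rule fps_ext)
  fix n
  let ?e = "\<lambda>(k, m). pent k + tri m"
  define F where "F = {x. ?e x = n}"
  define A where "A = {x\<in>F. even (fst x + snd x)}"
  define B where "B = {x\<in>F. odd (fst x + snd x)}"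
  define t where "t = (\<lambda>(k, m). (- ((m + k) div 2), (3 * k - m + 2) div 2) :: int \<times> int)"
  \<comment> \<open>The inverse of \<open>t\<close>; on the relevant pairs all the divisions are exact.\<close>
  define s where "s = (\<lambda>(k, m). ((m - k - 1) div 2, - 2 * k - (m - k - 1) div 2) :: int \<times> int)"
  have fin: "finite_fibres UNIV pent" "finite_fibres UNIV tri"
    using finite_fibres_pent [of 1] finite_fibres_tri [of 1] by simp_all
  have finF: "finite F"
    using finite_fibres_Times [OF fin] by (simp add: finite_fibres_def F_def)
  have F_iff: "(k, m) \<in> F \<longleftrightarrow> k * (3 * k + 1) + m * (m - 1) = 2 * int n" for k m
    unfolding F_def using int_pent [of k] int_tri [of m] by auto
  have t: "t x \<in> B" "s (t x) = x" and t_weight: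
      "(6 * fst x + 1) + (6 * fst (t x) + 1) = (2 * snd (t x) - 1) - (2 * snd x - 1)"
    if x: "x \<in> A" for x
  proof -
    obtain k m where km: "x = (k, m)" by (cases x)
    have F: "k * (3 * k + 1) + m * (m - 1) = 2 * int n" and ev: "even (m + k)"
      using x by (auto simp: A_def km F_iff add.commute)
    from ev obtain a where a: "m = 2 * a - k" by (metis add_diff_cancel_right' dvd_def)
    have tx: "t x = (- a, 2 * k - a + 1)" by (simp add: t_def km a)
    have "(- a) * (3 * (- a) + 1) + (2 * k - a + 1) * (2 * k - a + 1 - 1) = 2 * int n"
      using F unfolding a by (simp add: algebra_simps)
    moreover have "odd (- a + (2 * k - a + 1))" by simp
    ultimately show "t x \<in> B" unfolding tx B_def by (simp add: F_iff)
    show "s (t x) = x" unfolding tx by (simp add: s_def km a)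
    show "(6 * fst x + 1) + (6 * fst (t x) + 1) = (2 * snd (t x) - 1) - (2 * snd x - 1)"
      unfolding tx by (simp add: km a)
  qed
  have s: "s x \<in> A" "t (s x) = x" if x: "x \<in> B" for x
  proof -
    obtain k m where km: "x = (k, m)" by (cases x)
    have F: "k * (3 * k + 1) + m * (m - 1) = 2 * int n" and "even (m - k - 1)"
      using x by (auto simp: B_def km F_iff)
    then obtain a where "m - k - 1 = 2 * a" by blast
    then have a: "m = 2 * a + k + 1" by simp
    have sx: "s x = (a, - 2 * k - a)" by (simp add: s_def km a)
    have "a * (3 * a + 1) + (- 2 * k - a) * (- 2 * k - a - 1) = 2 * int n"
      using F unfolding a by (simp add: algebra_simps)
    then show "s x \<in> A" unfolding sx A_def by (simp add: F_iff)
    show "t (s x) = x" unfolding sx by (simp add: t_def km a)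
  qed
  have split: "(\<Sum>x\<in>F. f x) = (\<Sum>x\<in>A. f x + f (t x))" for f :: "int \<times> int \<Rightarrow> int"
  proof -
    have "(\<Sum>x\<in>F. f x) = (\<Sum>x\<in>A \<union> B. f x)"
      by (rule sum.cong) (auto simp: A_def B_def)
    also have "\<dots> = (\<Sum>x\<in>A. f x) + (\<Sum>x\<in>B. f x)"
      using finF by (intro sum.union_disjoint) (auto simp: A_def B_def)
    also have "(\<Sum>x\<in>B. f x) = (\<Sum>x\<in>A. f (t x))"
      by (rule sum.reindex_bij_witness [of _ t s]) (auto simp: t s)
    finally show ?thesis by (simp add: sum.distrib)
  qed
  define u where "u = (\<lambda>(k, m). parity_sign k * (- parity_sign m * (2 * m - 1)))"
  have u: "u x = (if even (fst x + snd x) then - (2 * snd x - 1) else 2 * snd x - 1)" for x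
    by (cases x) (auto simp: u_def parity_sign_def)
  have "(\<Sum>x\<in>F. 6 * fst x + 1) = (\<Sum>x\<in>F. u x)"
    unfolding split
  proof (rule sum.cong)
    fix x assume x: "x \<in> A"
    then have "even (fst x + snd x)" "odd (fst (t x) + snd (t x))"
      using t(1) [OF x] by (auto simp: A_def B_def)
    then show "6 * fst x + 1 + (6 * fst (t x) + 1) = u x + u (t x)"
      using t_weight [OF x] unfolding u by simp
  qed simp
  then show "(weighted_pentagonal * enum_series UNIV tri (\<lambda>_. 1)) $ n =
     (enum_series UNIV pent parity_sign * enum_series UNIV tri (\<lambda>j. - parity_sign j * (2 * j - 1))) $ n"
    unfolding weighted_pentagonal_def enum_series_mult [OF fin]
    by (simp add: enum_series_nth F_def u_def case_prod_unfold)
qed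

corollary weighted_pentagonal_eq: "weighted_pentagonal * euler 2 ^ 2 = euler 1 ^ 5"
proof -
  have "2 * (weighted_pentagonal * euler 2 ^ 2) = weighted_pentagonal * enum_series UNIV tri (\<lambda>_. 1) * euler 1"
    using triangular_series_eq by (simp add: mult_ac)
  also have "\<dots> = euler 1 * (2 * euler 1 ^ 3) * euler 1"
    unfolding weighted_pentagonal_mult_triangular using euler_pentagonal [of 1] jacobi_euler_cube [of 1] by simp
  also have "\<dots> = 2 * euler 1 ^ 5" by (simp add: eval_nat_numeral)
  finally show ?thesis by simp
qed

section \<open>The generating series of SNO\<close>

definition partitions :: "nat multiset set" where
  "partitions = {P. \<forall>p\<in>#P. 0 < p}"

definition distinct_partitions :: "nat set set" where
  "distinct_partitions = {D. finite D \<and> (\<forall>d\<in>D. 0 < d)}"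

abbreviation partition_series :: "int fps" where
  "partition_series \<equiv> enum_series partitions sum_mset (\<lambda>_. 1)"

abbreviation distinct_series :: "int fps" where
  "distinct_series \<equiv> enum_series distinct_partitions Sum (\<lambda>_. 1)"

lemma finite_fibres_partitions: "finite_fibres partitions sum_mset"
  unfolding finite_fibres_def
proof
  fix n
  have "{P\<in>partitions. \<Sum>\<^sub># P = n} \<subseteq> snd ` overpartitions n"
  proof
    fix P assume "P \<in> {P\<in>partitions. \<Sum>\<^sub># P = n}"
    then have "({}, P) \<in> overpartitions n" by (auto simp: overpartitions_def partitions_def)
    then show "P \<in> snd ` overpartitions n" by force
  qed
  then show "finite {P\<in>partitions. \<Sum>\<^sub># P = n}"
    by (rule finite_subset) (simp add: finite_overpartitions)
qed

lemma finite_fibres_distinct_partitions: "finite_fibres distinct_partitions Sum"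
  unfolding finite_fibres_def
proof
  fix n
  have "{D\<in>distinct_partitions. \<Sum>D = n} \<subseteq> fst ` overpartitions n"
  proof
    fix D assume "D \<in> {D\<in>distinct_partitions. \<Sum>D = n}"
    then have "(D, {#}) \<in> overpartitions n" by (auto simp: overpartitions_def distinct_partitions_def)
    then show "D \<in> fst ` overpartitions n" by force
  qed
  then show "finite {D\<in>distinct_partitions. \<Sum>D = n}"
    by (rule finite_subset) (simp add: finite_overpartitions)
qed

lemma card_split_filter: "finite A \<Longrightarrow> card A = card {x\<in>A. Q x} + card {x\<in>A. \<not> Q x}"
  by (subst card_Un_disjoint [symmetric]) (auto intro: arg_cong [of _ _ card])

text \<open>
  Partitions into parts at most \<open>M\<close> satisfy a recursion in \<open>M\<close>: those that contain the part \<open>M + 1\<close> arise from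
  arbitrary ones by adding one such part. Parts larger than \<open>N\<close> do not affect the degrees up to \<open>N\<close>.
\<close>
lemma partition_series_mult_euler:
  "partition_series * euler 1 = 1"
proof (rule agree_upto_eqI)
  fix N :: nat
  let ?S = "\<lambda>M. enum_series {P. set_mset P \<subseteq> {1..M}} sum_mset (\<lambda>_. 1)"
  have step: "?S (Suc M) * (1 - fps_X ^ Suc M) = ?S M" for M
  proof (rule fps_ext)
    fix n :: nat
    let ?A = "\<lambda>(M :: nat) (n :: nat). {P. set_mset P \<subseteq> {1..M} \<and> \<Sum>\<^sub># P = n}"
    have fin: "finite (?A M n)" for M n
    proof (rule finite_subset)
      show "?A M n \<subseteq> {P\<in>partitions. \<Sum>\<^sub># P = n}" by (auto simp: partitions_def)
    qed (use finite_fibres_partitions in \<open>simp add: finite_fibres_def\<close>)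
    have S: "?S M $ n = int (card (?A M n))" for M n
      by (simp add: enum_series_nth)
    have "{P\<in>?A (Suc M) n. Suc M \<in># P} = (if Suc M \<le> n then add_mset (Suc M) ` ?A (Suc M) (n - Suc M) else {})"
    proof (intro set_eqI iffI)
      fix P assume P: "P \<in> {P\<in>?A (Suc M) n. Suc M \<in># P}"
      then obtain P' where P': "P = add_mset (Suc M) P'" by (auto dest: multi_member_split)
      then show "P \<in> (if Suc M \<le> n then add_mset (Suc M) ` ?A (Suc M) (n - Suc M) else {})"
        using P by auto
    qed (auto split: if_splits)
    then have "card {P\<in>?A (Suc M) n. Suc M \<in># P} = (if Suc M \<le> n then card (?A (Suc M) (n - Suc M)) else 0)"
      by (simp add: card_image inj_on_def)
    moreover have "?A M n = {P\<in>?A (Suc M) n. Suc M \<notin># P}"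
      by (auto simp: subset_iff le_Suc_eq)
    moreover have "card (?A (Suc M) n) = card {P\<in>?A (Suc M) n. Suc M \<in># P} + card {P\<in>?A (Suc M) n. Suc M \<notin># P}"
      by (rule card_split_filter [OF fin])
    ultimately have "int (card (?A (Suc M) n)) - (if Suc M \<le> n then int (card (?A (Suc M) (n - Suc M))) else 0)
        = int (card (?A M n))"
      by auto
    then show "(?S (Suc M) * (1 - fps_X ^ Suc M)) $ n = ?S M $ n"
      by (simp only: right_diff_distrib fps_sub_nth mult_1_right fps_X_power_mult_right_nth S) auto
  qed
  have finite: "?S M * qpoch fps_X M = 1" for M
  proof (induction M)
    case 0
    show ?case by (rule fps_ext) (auto simp: enum_series_nth cong: conj_cong)
  next
    case (Suc M)
    have "?S (Suc M) * qpoch fps_X (Suc M) = ?S (Suc M) * (1 - fps_X ^ Suc M) * qpoch fps_X M"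
      by (simp only: qpoch_Suc mult_ac)
    then show ?case by (simp only: step Suc.IH)
  qed
  have "agree_upto N (partition_series) (?S N)"
    unfolding agree_upto_def
  proof (intro allI impI)
    fix i assume i: "i \<le> N"
    have "{P\<in>partitions. \<Sum>\<^sub># P = i} = {P. set_mset P \<subseteq> {1..N} \<and> \<Sum>\<^sub># P = i}"
    proof (intro set_eqI iffI)
      fix P assume P: "P \<in> {P\<in>partitions. \<Sum>\<^sub># P = i}"
      have "p \<in> {1..N}" if p: "p \<in># P" for p
      proof -
        have "p \<le> \<Sum>\<^sub># P" using p by (auto dest: multi_member_split)
        then show ?thesis using P p i by (auto simp: partitions_def Suc_le_eq)
      qed
      then show "P \<in> {P. set_mset P \<subseteq> {1..N} \<and> \<Sum>\<^sub># P = i}" using P by blast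
    qed (auto simp: partitions_def)
    then show "partition_series $ i = ?S N $ i"
      by (simp add: enum_series_nth)
  qed
  then have "agree_upto N (partition_series * euler 1) (?S N * qpoch fps_X N)"
    using agree_qpoch [of 1 N N] by (intro agree_upto_mult) (auto intro: agree_upto_sym)
  then show "agree_upto N (partition_series * euler 1) 1"
    unfolding finite .
qed

text \<open>
  The series of partitions into distinct parts is the product of the \<open>1 + q^i\<close>, and
  \<open>(1 + q^i) * (1 - q^i) = 1 - q^(2*i)\<close>.
\<close>
lemma distinct_partition_series_mult_euler:
  "distinct_series * euler 1 = euler 2"
proof (rule agree_upto_eqI)
  fix N :: nat
  let ?S = "\<lambda>M. enum_series (Pow {1..M}) Sum (\<lambda>_. 1)"
  have step: "?S (Suc M) = ?S M * (1 + fps_X ^ Suc M)" for M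
  proof (rule fps_ext)
    fix n :: nat
    let ?A = "\<lambda>(M :: nat) (n :: nat). {D\<in>Pow {1..M}. \<Sum>D = n}"
    have fin: "finite (?A M n)" for M n
      by (rule finite_subset [of _ "Pow {1..M}"]) auto
    have S: "?S M $ n = int (card (?A M n))" for M n
      by (simp add: enum_series_nth)
    have fresh: "finite D" "Suc M \<notin> D" if "D \<in> Pow {1..M}" for D
      using that finite_subset [of D "{1..M}"] by auto
    have "{D\<in>?A (Suc M) n. Suc M \<in> D} = (if Suc M \<le> n then insert (Suc M) ` ?A M (n - Suc M) else {})"
    proof (intro set_eqI iffI)
      fix D assume D: "D \<in> {D\<in>?A (Suc M) n. Suc M \<in> D}"
      define D' where "D' = D - {Suc M}"
      have D': "D = insert (Suc M) D'" "D' \<in> Pow {1..M}"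
        using D by (auto simp: D'_def le_Suc_eq)
      then show "D \<in> (if Suc M \<le> n then insert (Suc M) ` ?A M (n - Suc M) else {})"
        using D fresh [OF D'(2)] by auto
    next
      fix D assume "D \<in> (if Suc M \<le> n then insert (Suc M) ` ?A M (n - Suc M) else {})"
      then obtain D' where "Suc M \<le> n" "D' \<in> Pow {1..M}" "\<Sum>D' = n - Suc M" "D = insert (Suc M) D'"
        by (auto split: if_splits)
      then show "D \<in> {D\<in>?A (Suc M) n. Suc M \<in> D}"
        using fresh [of D'] by auto
    qed
    moreover have "inj_on (insert (Suc M)) (?A M (n - Suc M))"
    proof (rule inj_onI)
      fix C D assume "C \<in> ?A M (n - Suc M)" "D \<in> ?A M (n - Suc M)" "insert (Suc M) C = insert (Suc M) D"
      then show "C = D" using fresh [of C] fresh [of D] by (metis (no_types, lifting) Diff_insert_absorb mem_Collect_eq)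
    qed
    ultimately have "card {D\<in>?A (Suc M) n. Suc M \<in> D} = (if Suc M \<le> n then card (?A M (n - Suc M)) else 0)"
      by (simp add: card_image)
    moreover have "?A M n = {D\<in>?A (Suc M) n. Suc M \<notin> D}"
      by (auto simp: subset_iff le_Suc_eq)
    moreover have "card (?A (Suc M) n) = card {D\<in>?A (Suc M) n. Suc M \<in> D} + card {D\<in>?A (Suc M) n. Suc M \<notin> D}"
      by (rule card_split_filter [OF fin])
    ultimately have "int (card (?A (Suc M) n))
        = int (card (?A M n)) + (if Suc M \<le> n then int (card (?A M (n - Suc M))) else 0)"
      by auto
    then show "?S (Suc M) $ n = (?S M * (1 + fps_X ^ Suc M)) $ n"
      by (simp only: distrib_left fps_add_nth mult_1_right fps_X_power_mult_right_nth S) auto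
  qed
  have finite: "?S M * qpoch fps_X M = qpoch (fps_X ^ 2) M" for M
  proof (induction M)
    case 0
    show ?case by (rule fps_ext) (auto simp: enum_series_nth cong: conj_cong)
  next
    case (Suc M)
    have "(1 + fps_X ^ Suc M) * (1 - fps_X ^ Suc M) = (1 - (fps_X ^ 2) ^ Suc M :: int fps)"
      by (simp add: algebra_simps flip: power_mult power_add)
    moreover have "?S (Suc M) * qpoch fps_X (Suc M)
        = (?S M * qpoch fps_X M) * ((1 + fps_X ^ Suc M) * (1 - fps_X ^ Suc M))"
      by (simp only: step qpoch_Suc mult_ac)
    ultimately show ?case by (simp only: Suc.IH qpoch_Suc)
  qed
  have "agree_upto N (distinct_series) (?S N)"
    unfolding agree_upto_def
  proof (intro allI impI)
    fix i assume i: "i \<le> N"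
    have "{D\<in>distinct_partitions. \<Sum>D = i} = {D. D \<in> Pow {1..N} \<and> \<Sum>D = i}"
    proof (intro set_eqI iffI)
      fix D assume D: "D \<in> {D\<in>distinct_partitions. \<Sum>D = i}"
      have "d \<in> {1..N}" if d: "d \<in> D" for d
      proof -
        have "d \<le> \<Sum>D"
          using D d member_le_sum [of d D "\<lambda>x. x"] by (simp add: distinct_partitions_def)
        then show ?thesis using D d i by (auto simp: distinct_partitions_def Suc_le_eq)
      qed
      then show "D \<in> {D. D \<in> Pow {1..N} \<and> \<Sum>D = i}" using D by blast
    qed (auto simp: distinct_partitions_def intro: finite_subset)
    then show "distinct_series $ i = ?S N $ i"
      by (simp add: enum_series_nth)
  qed
  then have "agree_upto N (distinct_series * euler 1) (?S N * qpoch fps_X N)"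
    using agree_qpoch [of 1 N N] by (intro agree_upto_mult) (auto intro: agree_upto_sym)
  also have "agree_upto N (?S N * qpoch fps_X N) (euler 2)"
    unfolding finite using agree_qpoch [of 2 N N] by simp
  finally show "agree_upto N (distinct_series * euler 1) (euler 2)" .
qed

definition overpartition_series :: "int fps" where
  "overpartition_series = distinct_series * partition_series"

definition SNO_series :: "int fps" where
  "SNO_series = Abs_fps (\<lambda>n. int (SNO n))"

lemma overpartition_series_mult_euler: "overpartition_series * euler 1 ^ 2 = euler 2"
proof -
  have "overpartition_series * euler 1 ^ 2
      = (partition_series * euler 1) * (distinct_series * euler 1)"
    by (simp only: overpartition_series_def power2_eq_square mult_ac)
  then show ?thesis
    by (simp only: partition_series_mult_euler distinct_partition_series_mult_euler mult_1_left)
qed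

text \<open>
  Weighting the non-overlined part of an overpartition by its sum is differentiating the factor \<open>1 / euler 1\<close>.
\<close>
lemma SNO_series_mult_euler: "SNO_series * euler 1 = - overpartition_series * fps_XD (euler 1)"
proof -
  have SNO: "SNO_series = distinct_series * fps_XD partition_series"
  proof (rule fps_ext)
    fix n
    have "{x \<in> distinct_partitions \<times> partitions. (case x of (D, P) \<Rightarrow> \<Sum>D + \<Sum>\<^sub># P) = n} = overpartitions n"
      by (auto simp: overpartitions_def partitions_def distinct_partitions_def)
    then show "SNO_series $ n = (distinct_series * fps_XD partition_series) $ n"
      unfolding fps_XD_enum_series enum_series_nth
        enum_series_mult [OF finite_fibres_distinct_partitions finite_fibres_partitions]
      by (simp add: SNO_series_def SNO_def case_prod_unfold)
  qed
  have deriv: "fps_XD partition_series * euler 1 = - (partition_series * fps_XD (euler 1))"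
  proof -
    have "fps_XD (partition_series * euler 1) = 0"
      unfolding partition_series_mult_euler by (simp add: fps_XD_def)
    then show ?thesis by (simp only: fps_XD_mult eq_neg_iff_add_eq_0)
  qed
  show ?thesis
    by (simp only: SNO mult.assoc deriv overpartition_series_def mult_minus_left mult_minus_right)
qed

text \<open>
  The fifth power is the one for which \<open>f\<^sub>1^2 * \<theta> f\<^sub>1\<close> appears next to \<open>P * f\<^sub>1^2 = f\<^sub>2\<close>, that is, the derivative of
  Jacobi's series.
\<close>
lemma SNO_series_mult_euler_5: "6 * (SNO_series * euler 1 ^ 5) = - fps_XD (2 * euler 1 ^ 3) * euler 2"
proof -
  have "fps_XD (2 * euler 1 ^ 3) = 6 * (euler 1 ^ 2 * fps_XD (euler 1))"
    using fps_XD_power_Suc [of "euler 1" 2] by (simp add: fps_XD_numeral_mult)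
  moreover have "6 * (SNO_series * euler 1 ^ 5) = 6 * ((SNO_series * euler 1) * euler 1 ^ 4)"
    by (simp add: eval_nat_numeral mult_ac)
  moreover have "\<dots> = - (6 * (euler 1 ^ 2 * fps_XD (euler 1))) * (overpartition_series * euler 1 ^ 2)"
    unfolding SNO_series_mult_euler by (simp add: eval_nat_numeral mult_ac)
  ultimately show ?thesis
    by (simp only: overpartition_series_mult_euler)
qed

text \<open>
  Differentiating \<open>P * f\<^sub>1^2 = f\<^sub>2\<close> gives \<open>\<theta> P * f\<^sub>1^2 - 2 * S * f\<^sub>1^2 = \<theta> f\<^sub>2\<close>. After multiplication by \<open>f\<^sub>1^5 = Q * f\<^sub>2^2\<close> the right-hand
  side becomes a third of \<open>\<theta> (f\<^sub>2^3) * Q\<close>; and \<open>\<theta> P * f\<^sub>1^7\<close> is \<open>\<theta> (P * f\<^sub>1^7) = \<theta> (f\<^sub>2^3 * Q)\<close> except for a multiple of 7.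
\<close>
lemma SNO_series_mult_euler_7:
  "12 * (SNO_series * euler 1 ^ 7) =
     3 * fps_XD (2 * euler 2 ^ 3 * weighted_pentagonal) - fps_XD (2 * euler 2 ^ 3) * weighted_pentagonal
     - 42 * (overpartition_series * euler 1 ^ 6 * fps_XD (euler 1))"
proof -
  define E F P Q S where "E = euler 1" and "F = euler 2" and "P = overpartition_series"
    and "Q = weighted_pentagonal" and "S = SNO_series"
  have SE: "S * E = - P * fps_XD E" and PE: "P * E ^ 2 = F" and QF: "Q * F ^ 2 = E ^ 5"
    using SNO_series_mult_euler overpartition_series_mult_euler weighted_pentagonal_eq
    by (simp_all add: E_def F_def P_def Q_def S_def)
  have dE2: "fps_XD (E ^ 2) = 2 * E * fps_XD E" and dE7: "fps_XD (E ^ 7) = 7 * E ^ 6 * fps_XD E"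
    and dF3: "fps_XD (F ^ 3) = 3 * F ^ 2 * fps_XD F"
    using fps_XD_power_Suc [of E 6] fps_XD_power_Suc [of F 2]
    by (simp_all add: power2_eq_square fps_XD_mult)
  have PE7: "P * E ^ 7 = F ^ 3 * Q"
  proof -
    have "P * E ^ 7 = (P * E ^ 2) * E ^ 5" by (simp add: eval_nat_numeral mult_ac)
    also have "\<dots> = F ^ 3 * Q" unfolding PE QF [symmetric] by (simp add: eval_nat_numeral mult_ac)
    finally show ?thesis .
  qed
  have dF: "fps_XD F = fps_XD P * E ^ 2 - 2 * S * E ^ 2"
  proof -
    have "fps_XD F = fps_XD P * E ^ 2 + 2 * (P * fps_XD E) * E"
      unfolding PE [symmetric] fps_XD_mult dE2 by (simp add: mult_ac)
    also have "P * fps_XD E = - (S * E)" by (simp add: SE)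
    finally show ?thesis by (simp add: power2_eq_square mult_ac)
  qed
  have "fps_XD (F ^ 3) * Q = 3 * fps_XD F * (Q * F ^ 2)"
    unfolding dF3 by (simp add: mult_ac)
  also have "\<dots> = 3 * (fps_XD P * E ^ 7) - 6 * (S * E ^ 7)"
    unfolding QF dF by (simp add: algebra_simps eval_nat_numeral)
  finally have 1: "fps_XD (F ^ 3) * Q = 3 * (fps_XD P * E ^ 7) - 6 * (S * E ^ 7)" .
  have 2: "fps_XD (F ^ 3 * Q) = fps_XD P * E ^ 7 + 7 * (P * E ^ 6 * fps_XD E)"
    unfolding PE7 [symmetric] fps_XD_mult dE7 by (simp add: mult_ac)
  have "12 * (S * E ^ 7) = 3 * (2 * fps_XD (F ^ 3 * Q)) - 2 * (fps_XD (F ^ 3) * Q) - 42 * (P * E ^ 6 * fps_XD E)"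
    unfolding 1 2 by (simp add: algebra_simps)
  then show ?thesis
    by (simp add: E_def F_def P_def Q_def S_def fps_XD_numeral_mult mult.assoc)
qed

section \<open>Divisibility in residue classes\<close>

text \<open>
  The coefficient is multiplied by \<open>n\<close> under \<open>fps_XD\<close>, and \<open>fps_XD (f ^ p)\<close> is \<open>p\<close> times a series.
\<close>
lemma prime_dvd_power_nth:
  assumes "prime p" "\<not> p dvd n"
  shows "int p dvd (f ^ p) $ n"
proof -
  obtain m where m: "p = Suc m" using prime_gt_0_nat [OF assms(1)] gr0_implies_Suc by blast
  have "int n * (f ^ p) $ n = fps_XD (f ^ p) $ n" by (simp only: fps_XD_nth)
  also have "\<dots> = int p * (f ^ m * fps_XD f) $ n"
    unfolding m fps_XD_power_Suc mult.assoc fps_of_nat [symmetric] by (simp only: fps_mult_left_const_nth)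
  finally have "int p dvd int n * (f ^ p) $ n" by simp
  moreover have "\<not> int p dvd int n" using assms(2) by simp
  ultimately show ?thesis using assms(1) by (simp add: prime_dvd_mult_iff)
qed

text \<open>
  Modulo \<open>p\<close> the factor \<open>f ^ p\<close> is a series in \<open>q^p\<close> with constant coefficient 1, so multiplication by it acts on
  each residue class of coefficients separately and invertibly.
\<close>
lemma residue_class_dvd:
  assumes p: "prime p" and f: "f $ 0 = 1"
    and g: "\<And>n. n mod p = r \<Longrightarrow> int p dvd (h * f ^ p) $ n"
    and n: "n mod p = r"
  shows "int p dvd h $ n"
  using n
proof (induction n rule: less_induct)
  case (less n)
  have "(h * f ^ p) $ n = h $ n + (\<Sum>i<n. h $ i * (f ^ p) $ (n - i))"
  proof -
    have "{0..n} = insert n {..<n}" by auto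
    then show ?thesis using f by (simp add: fps_mult_nth fps_power_zeroth)
  qed
  moreover have "int p dvd (\<Sum>i<n. h $ i * (f ^ p) $ (n - i))"
  proof (rule dvd_sum)
    fix i assume i: "i \<in> {..<n}"
    show "int p dvd h $ i * (f ^ p) $ (n - i)"
    proof (cases "p dvd n - i")
      case True
      then have "i mod p = r" using i less.prems by (metis lessThan_iff less_imp_le mod_eq_dvd_iff_nat)
      then show ?thesis using less.IH i by simp
    next
      case False
      then show ?thesis using prime_dvd_power_nth [OF p] by simp
    qed
  qed
  ultimately show ?case using g [OF less.prems] by (metis dvd_add_left_iff)
qed

text \<open>
  With \<open>x = 2*m - 1\<close> and \<open>y = 6*k + 1\<close>, the product is 0 modulo 5 unless \<open>x^2 = 4\<close>. In that case the
  expression in the hypothesis is \<open>1 + y^2\<close>, which can only be 0, 1 or 2.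
\<close>
lemma residues_mod_5:
  fixes m k :: int
  assumes "(m * (m - 1) + 2 * (k * (3 * k + 1))) mod 5 \<in> {3, 4}"
  shows "5 dvd m * (m - 1) * (2 * m - 1)"
proof -
  define a b where "a = m mod 5" and "b = k mod 5"
  have ab: "[a = m] (mod 5)" "[b = k] (mod 5)" by (simp_all add: a_def b_def cong_def)
  have cong: "[a * (a - 1) + 2 * (b * (3 * b + 1)) = m * (m - 1) + 2 * (k * (3 * k + 1))] (mod 5)"
    "[a * (a - 1) * (2 * a - 1) = m * (m - 1) * (2 * m - 1)] (mod 5)"
    by (intro cong_add cong_mult cong_diff cong_refl ab)+
  have "a = 0 \<or> a = 1 \<or> a = 2 \<or> a = 3 \<or> a = 4" unfolding a_def by presburger
  moreover have "b = 0 \<or> b = 1 \<or> b = 2 \<or> b = 3 \<or> b = 4" unfolding b_def by presburger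
  moreover have "(a * (a - 1) + 2 * (b * (3 * b + 1))) mod 5 \<in> {3, 4}"
    using assms cong unfolding cong_def by simp
  ultimately have "(a * (a - 1) * (2 * a - 1)) mod 5 = 0"
    by (elim disjE) simp_all
  then show ?thesis using cong(2) unfolding cong_def by (simp add: mod_eq_0_iff_dvd)
qed

text \<open>
  With \<open>x = 2*m - 1\<close> and \<open>y = 6*k + 1\<close>, the hypothesis says \<open>y^2 - x^2 = 2\<close> modulo 7. Both being squares, the
  solutions are \<open>(x^2, y^2) = (0, 2)\<close> and \<open>(2, 4)\<close>; in the first the factor \<open>x\<close> is 0, in the second \<open>m * (m - 1) = 2\<close>,
  which is 9 modulo 7.
\<close>
lemma residues_mod_7:
  fixes m k :: int
  assumes "(2 * (m * (m - 1)) + k * (3 * k + 1)) mod 7 = 6"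
  shows "7 dvd (2 * m - 1) * (6 * k + 1) * (9 - m * (m - 1))"
proof -
  define a b where "a = m mod 7" and "b = k mod 7"
  have ab: "[a = m] (mod 7)" "[b = k] (mod 7)" by (simp_all add: a_def b_def cong_def)
  have cong: "[2 * (a * (a - 1)) + b * (3 * b + 1) = 2 * (m * (m - 1)) + k * (3 * k + 1)] (mod 7)"
    "[(2 * a - 1) * (6 * b + 1) * (9 - a * (a - 1)) = (2 * m - 1) * (6 * k + 1) * (9 - m * (m - 1))] (mod 7)"
    by (intro cong_add cong_mult cong_diff cong_refl ab)+
  have "a = 0 \<or> a = 1 \<or> a = 2 \<or> a = 3 \<or> a = 4 \<or> a = 5 \<or> a = 6" unfolding a_def by presburger
  moreover have "b = 0 \<or> b = 1 \<or> b = 2 \<or> b = 3 \<or> b = 4 \<or> b = 5 \<or> b = 6" unfolding b_def by presburger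
  moreover have "(2 * (a * (a - 1)) + b * (3 * b + 1)) mod 7 = 6"
    using assms cong unfolding cong_def by simp
  ultimately have "((2 * a - 1) * (6 * b + 1) * (9 - a * (a - 1))) mod 7 = 0"
    by (elim disjE) simp_all
  then show ?thesis using cong(2) unfolding cong_def by (simp add: mod_eq_0_iff_dvd)
qed

text \<open>
  Twice the exponent of the term \<open>(m, k)\<close> is the expression that \<open>residues_mod_5\<close> restricts, and the weight of
  the term is divisible by 5 because the derivative multiplies Jacobi's weight \<open>2*m - 1\<close> by the triangular number.
\<close>
lemma SNO_series_mod_5:
  assumes "n mod 5 = 2 \<or> n mod 5 = 4"
  shows "5 dvd (SNO_series * euler 1 ^ 5) $ n"
proof -
  let ?J = "\<lambda>j. - parity_sign j * (2 * j - 1)"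
  have fin: "finite_fibres UNIV (\<lambda>j. 1 * tri j)" "finite_fibres UNIV (\<lambda>k. 2 * pent k)"
    by (rule finite_fibres_tri finite_fibres_pent, simp)+
  have terms: "5 dvd int (1 * tri m) * ?J m * parity_sign k" if mk: "1 * tri m + 2 * pent k = n" for m k
  proof -
    have m: "2 * int (tri m) = m * (m - 1)" by (rule int_tri)
    have "m * (m - 1) + 2 * (k * (3 * k + 1)) = 2 * int n"
      unfolding mk [symmetric] int_tri [symmetric] int_pent [symmetric] by simp
    moreover have "2 * int n mod 5 = 4 \<or> 2 * int n mod 5 = 3"
      using assms by presburger
    ultimately have "(m * (m - 1) + 2 * (k * (3 * k + 1))) mod 5 \<in> {3, 4}" by auto
    then have "5 dvd m * (m - 1) * (2 * m - 1)" by (rule residues_mod_5)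
    also have "m * (m - 1) * (2 * m - 1) = 2 * (int (tri m) * (2 * m - 1))"
      by (simp only: m mult.assoc [symmetric])
    finally have "5 dvd int (tri m) * (2 * m - 1)" by presburger
    moreover have "int (1 * tri m) * ?J m * parity_sign k
        = int (tri m) * (2 * m - 1) * (- parity_sign m * parity_sign k)"
      by (simp add: algebra_simps)
    ultimately show ?thesis by (metis dvd_mult2)
  qed
  have "5 dvd (fps_XD (2 * euler 1 ^ 3) * euler 2) $ n"
    unfolding jacobi_euler_cube [OF order_refl] euler_pentagonal [OF one_le_numeral] fps_XD_enum_series
      enum_series_mult [OF fin] enum_series_nth
    by (rule dvd_sum) (use terms in force)
  then have "5 dvd (6 * (SNO_series * euler 1 ^ 5)) $ n"
    unfolding SNO_series_mult_euler_5 by simp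
  then have "5 dvd 6 * (SNO_series * euler 1 ^ 5) $ n"
    by (simp only: numeral_fps_const fps_mult_left_const_nth)
  then show ?thesis by presburger
qed

text \<open>
  The derivatives multiply the term \<open>(m, k)\<close> of degree \<open>n\<close> by \<open>3 * n - m * (m - 1)\<close>, which for \<open>n = 3\<close> modulo 7 is
  the last factor in \<open>residues_mod_7\<close>.
\<close>
lemma SNO_series_mod_7:
  assumes "n mod 7 = 3"
  shows "7 dvd (SNO_series * euler 1 ^ 7) $ n"
proof -
  let ?J = "\<lambda>j. - parity_sign j * (2 * j - 1)"
  let ?J2 = "enum_series UNIV (\<lambda>j. 2 * tri j) ?J"
  have fin: "finite_fibres UNIV (\<lambda>j. 2 * tri j)" "finite_fibres UNIV pent"
    using finite_fibres_tri [of 2] finite_fibres_pent [of 1] by simp_all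
  have J2: "2 * euler 2 ^ 3 = ?J2"
    by (rule jacobi_euler_cube) simp
  let ?I = "{x \<in> UNIV \<times> UNIV. (case x of (m, k) \<Rightarrow> 2 * tri m + pent k) = n}"
  let ?w = "\<lambda>(m, k). (3 * int (2 * tri m + pent k) - int (2 * tri m)) * (?J m * (6 * k + 1))"
  have terms: "7 dvd ?w x" if "x \<in> ?I" for x
  proof -
    obtain m k where x: "x = (m, k)" by (cases x)
    then have mk: "2 * tri m + pent k = n" using that by simp
    have "2 * (m * (m - 1)) + k * (3 * k + 1) = 2 * int n"
      unfolding mk [symmetric] int_tri [symmetric] int_pent [symmetric] by simp
    moreover have "2 * int n mod 7 = 6" using assms by presburger
    ultimately have "7 dvd (2 * m - 1) * (6 * k + 1) * (9 - m * (m - 1))"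
      using residues_mod_7 by simp
    moreover have "\<exists>c. int n = 7 * c + 3" using assms by presburger
    then obtain c where c: "int n = 7 * c + 3" ..
    have "?w x = parity_sign m * (- 1) * ((2 * m - 1) * (6 * k + 1) * (9 - m * (m - 1)))
             + 7 * (3 * c * ?J m * (6 * k + 1))"
      unfolding x prod.case mk c int_tri [of m, symmetric] by (simp add: algebra_simps)
    ultimately show ?thesis by simp
  qed
  have "(3 * fps_XD (2 * euler 2 ^ 3 * weighted_pentagonal) - fps_XD (2 * euler 2 ^ 3) * weighted_pentagonal) $ n = (\<Sum>x\<in>?I. ?w x)"
    unfolding J2 weighted_pentagonal_def fps_XD_enum_series enum_series_mult [OF fin]
    unfolding numeral_fps_const
      fps_sub_nth fps_mult_left_const_nth enum_series_nth sum_distrib_left sum_subtractf [symmetric]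
    by (rule sum.cong) (auto simp: algebra_simps)
  then have theta: "7 dvd (3 * fps_XD (2 * euler 2 ^ 3 * weighted_pentagonal) - fps_XD (2 * euler 2 ^ 3) * weighted_pentagonal) $ n"
    using dvd_sum [of ?I 7 ?w] terms by simp
  have "(12 * (SNO_series * euler 1 ^ 7)) $ n =
      (3 * fps_XD (2 * euler 2 ^ 3 * weighted_pentagonal) - fps_XD (2 * euler 2 ^ 3) * weighted_pentagonal) $ n
      - 42 * (overpartition_series * euler 1 ^ 6 * fps_XD (euler 1)) $ n"
    unfolding SNO_series_mult_euler_7 by (simp only: fps_sub_nth numeral_fps_const fps_mult_left_const_nth)
  moreover have "(12 * (SNO_series * euler 1 ^ 7)) $ n = 12 * (SNO_series * euler 1 ^ 7) $ n"
    by (simp only: numeral_fps_const fps_mult_left_const_nth)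
  ultimately show ?thesis using theta by presburger
qed

theorem theorem1p7:
  fixes n :: nat
  shows "[SNO (5 * n + 4) = 0] (mod 5) \<and>
         [SNO (5 * n + 2) = 0] (mod 5) \<and>
         [SNO (7 * n + 3) = 0] (mod 7)"
proof -
  have five: "5 dvd SNO l" if "l mod 5 = 2 \<or> l mod 5 = 4" for l
  proof -
    have "int 5 dvd SNO_series $ l"
      by (rule residue_class_dvd [where r = "l mod 5" and f = "euler 1"])
        (use that SNO_series_mod_5 in auto)
    then have "int 5 dvd int (SNO l)" by (simp add: SNO_series_def)
    then show ?thesis by (simp only: of_nat_dvd_iff)
  qed
  have seven: "7 dvd SNO l" if "l mod 7 = 3" for l
  proof -
    have "int 7 dvd SNO_series $ l"
      by (rule residue_class_dvd [where r = "l mod 7" and f = "euler 1"])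
        (use that SNO_series_mod_7 in auto)
    then have "int 7 dvd int (SNO l)" by (simp add: SNO_series_def)
    then show ?thesis by (simp only: of_nat_dvd_iff)
  qed
  have "(5 * n + 4) mod 5 = 4" "(5 * n + 2) mod 5 = 2" "(7 * n + 3) mod 7 = 3" by presburger+
  then show ?thesis using five seven by (simp add: cong_0_iff)
qed

end
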